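(* Assume that $\mathcal{E}$ is convex on $\Delta_{n_{\mathcal Y}}$, and let $G(\nu,k)=G(\nu)$ for all $\nu\in\Delta_{n_{\mathcal Y}}$, $k\in K$ (i.e. $G$ does not depend on $k$). Assume that $\nu^\ast$ is a minimizer of $G$ over $\Delta_{n_{\mathcal Y}}$ and that $\gamma^\ast$ is an optimizer for $\mathrm{OT}(\mu,\nu^\ast,c)$. Then, for any $k^\ast\in\left(-\partial_\nu\mathrm{OT}(\mu,\nu^\ast,c)-\nabla\mathcal{E}[\nu^\ast]\right)\cap K$, the pair $(\gamma^\ast,k^\ast)$ is a Stackelberg-Cournot-Nash equilibrium (SCNE). In particular, if $\nu^\ast$ lies in the relative interior of $\Delta_{n_{\mathcal Y}}$ and $K=\mathbb{R}^{n_{\mathcal Y}}$, then a SCNE exists.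
   Context: $\mathcal{X}=\{x_1,\ldots,x_{n_{\mathcal X}}\}$ (types) and $\mathcal{Y}=\{y_1,\ldots,y_{n_{\mathcal Y}}\}$ (actions) are finite sets. Probability measures on them are identified with vectors in $\Delta_{n_{\mathcal X}}$, $\Delta_{n_{\mathcal Y}}$, where $\Delta_n=\{\omega\in[0,1]^n:\sum_i\omega_i=1\}$; $\mu\in\Delta_{n_{\mathcal X}}$ is fixed. $\Pi(\mu,\cdot)$ is the set of probability measures $\gamma=(\gamma_{ij})$ on $\mathcal{X}\times\mathcal{Y}$ with first marginal $\mu$; $p_2\#\gamma$ is the second marginal of $\gamma$. The data are: $c\in\mathbb{R}^{n_{\mathcal X}\times n_{\mathcal Y}}$; continuous nondecreasing functions $f_j:[0,1]\to\mathbb{R}$, $j=1,\ldots,n_{\mathcal Y}$; a symmetric matrix $\theta\in\mathbb{R}^{n_{\mathcal Y}\times n_{\mathcal Y}}$; a set $K\subseteq\mathbb{R}^{n_{\mathcal Y}}$; and a continuous function $G:\Delta_{n_{\mathcal Y}}\times K\to\mathbb{R}$. For $\nu\in\Delta_{n_{\mathcal Y}}$, $k\in K$, $C_{ij}[\nu,k]=c_{ij}+k_j+f_j(\nu_j)+\sum_a\theta_{aj}\nu_a$. The energy is $\mathcal{E}[\nu]=\sum_jF_j(\nu_j)+\tfrac12\sum_{a,j}\theta_{aj}\nu_a\nu_j$, $F_j(t)=\int_0^tf_j(s)\,ds$, with gradient $(\nabla\mathcal{E}[\nu])_j=f_j(\nu_j)+\sum_a\theta_{aj}\nu_a$. $\mathrm{OT}(\mu,\nu,c)=\min_\gamma\sum_{i,j}c_{ij}\gamma_{ij}$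 over probability measures $\gamma$ on $\mathcal{X}\times\mathcal{Y}$ with marginals $\mu,\nu$; minimizers are called optimizers for $\mathrm{OT}(\mu,\nu,c)$. Its subdifferential in $\nu\in\Delta_{n_{\mathcal Y}}$ is $\partial_\nu\mathrm{OT}(\mu,\nu,c)=\{f\in\mathbb{R}^{n_{\mathcal Y}}:\mathrm{OT}(\mu,\nu,c)-f\cdot\nu\le\mathrm{OT}(\mu,\eta,c)-f\cdot\eta\ \forall\eta\in\Delta_{n_{\mathcal Y}}\}$. For $k\in K$, $\gamma^k\in\Pi(\mu,\cdot)$ is a Cournot-Nash equilibrium (CNE) w.r.t. $k$ if, with $\nu^k=p_2\#\gamma^k$, $\gamma^k$ minimizes $\gamma\mapsto\sum_{i,j}C_{ij}[\nu^k,k]\gamma_{ij}$ over $\gamma\in\Pi(\mu,\cdot)$. A pair $(\gamma^{k^*},k^* )\in\Pi(\mu,\cdot)\times K$ is a SCNE if (i) $\gamma^{k^*}$ is a CNE w.r.t. $k^*$, and (ii) $G(p_2\#\gamma^{k^*},k^* )\le G(p_2\#\gamma^k,k)$ for all $k\in K$ and all CNE $\gamma^k$ w.r.t. $k$. *)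

theory Defs
  imports "HOL-Analysis.Analysis"
begin

text \<open>
  The finite type and action sets are the index types \<open>'x\<close> and \<open>'y\<close>; a measure on their
  product is a matrix with entries \<open>\<gamma> $ i $ j\<close>, where \<open>i\<close> is a type and \<open>j\<close> an action.
\<close>

definition prob_simplex :: "(real ^ 'n::finite) set" where
  "prob_simplex = {\<omega>. (\<forall>i. \<omega> $ i \<in> {0..1}) \<and> (\<Sum>i\<in>UNIV. \<omega> $ i) = 1}"

definition prob_matrices :: "(real ^ 'y::finite ^ 'x::finite) set" where
  "prob_matrices = {\<gamma>. (\<forall>i j. \<gamma> $ i $ j \<in> {0..1}) \<and> (\<Sum>i\<in>UNIV. \<Sum>j\<in>UNIV. \<gamma> $ i $ j) = 1}"

definition marginal1 :: "real ^ 'y::finite ^ 'x::finite \<Rightarrow> real ^ 'x" where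
  "marginal1 \<gamma> = (\<chi> i. \<Sum>j\<in>UNIV. \<gamma> $ i $ j)"

definition marginal2 :: "real ^ 'y::finite ^ 'x::finite \<Rightarrow> real ^ 'y" where
  "marginal2 \<gamma> = (\<chi> j. \<Sum>i\<in>UNIV. \<gamma> $ i $ j)"

definition plans_from :: "real ^ 'x::finite \<Rightarrow> (real ^ 'y::finite ^ 'x) set" where
  "plans_from \<mu> = {\<gamma> \<in> prob_matrices. marginal1 \<gamma> = \<mu>}"

definition couplings :: "real ^ 'x::finite \<Rightarrow> real ^ 'y::finite \<Rightarrow> (real ^ 'y ^ 'x) set" where
  "couplings \<mu> \<nu> = {\<gamma> \<in> prob_matrices. marginal1 \<gamma> = \<mu> \<and> marginal2 \<gamma> = \<nu>}"

definition total_cost :: "real ^ 'y::finite ^ 'x::finite \<Rightarrow> real ^ 'y ^ 'x \<Rightarrow> real" where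
  "total_cost c \<gamma> = (\<Sum>i\<in>UNIV. \<Sum>j\<in>UNIV. c $ i $ j * \<gamma> $ i $ j)"

text \<open>
  For \<open>\<mu>\<close> and \<open>\<nu>\<close> in the simplex the infimum is a minimum: the set of couplings is nonempty
  (it contains the product measure) and compact. Outside the simplex the value is meaningless.
\<close>

definition OT :: "real ^ 'x::finite \<Rightarrow> real ^ 'y::finite \<Rightarrow> real ^ 'y ^ 'x \<Rightarrow> real" where
  "OT \<mu> \<nu> c = (INF \<gamma>\<in>couplings \<mu> \<nu>. total_cost c \<gamma>)"

definition OT_optimizer ::
  "real ^ 'x::finite \<Rightarrow> real ^ 'y::finite \<Rightarrow> real ^ 'y ^ 'x \<Rightarrow> real ^ 'y ^ 'x \<Rightarrow> bool" where
  "OT_optimizer \<mu> \<nu> c \<gamma> \<longleftrightarrow> is_arg_min (total_cost c) (\<lambda>\<gamma>'. \<gamma>' \<in> couplings \<mu> \<nu>) \<gamma>"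

definition OT_subdifferential ::
  "real ^ 'x::finite \<Rightarrow> real ^ 'y::finite \<Rightarrow> real ^ 'y ^ 'x \<Rightarrow> (real ^ 'y) set" where
  "OT_subdifferential \<mu> \<nu> c =
     {\<phi>. \<forall>\<eta>\<in>prob_simplex. OT \<mu> \<nu> c - \<phi> \<bullet> \<nu> \<le> OT \<mu> \<eta> c - \<phi> \<bullet> \<eta>}"

definition energy :: "('y::finite \<Rightarrow> real \<Rightarrow> real) \<Rightarrow> real ^ 'y ^ 'y \<Rightarrow> real ^ 'y \<Rightarrow> real" where
  "energy f \<theta> \<nu> = (\<Sum>j\<in>UNIV. integral {0..\<nu> $ j} (f j))
     + 1 / 2 * (\<Sum>a\<in>UNIV. \<Sum>j\<in>UNIV. \<theta> $ a $ j * \<nu> $ a * \<nu> $ j)"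

text \<open>
  The gradient for symmetric \<open>\<theta>\<close>, as an explicit formula: the data \<open>f j\<close> are meaningful on
  \<open>{0..1}\<close> only, so the energy need not be differentiable at boundary points of the simplex.
\<close>

definition grad_energy ::
  "('y::finite \<Rightarrow> real \<Rightarrow> real) \<Rightarrow> real ^ 'y ^ 'y \<Rightarrow> real ^ 'y \<Rightarrow> real ^ 'y" where
  "grad_energy f \<theta> \<nu> = (\<chi> j. f j (\<nu> $ j) + (\<Sum>a\<in>UNIV. \<theta> $ a $ j * \<nu> $ a))"

definition agent_cost ::
  "real ^ 'y::finite ^ 'x::finite \<Rightarrow> ('y \<Rightarrow> real \<Rightarrow> real) \<Rightarrow> real ^ 'y ^ 'y
     \<Rightarrow> real ^ 'y \<Rightarrow> real ^ 'y \<Rightarrow> real ^ 'y ^ 'x" where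
  "agent_cost c f \<theta> \<nu> k =
     (\<chi> i j. c $ i $ j + k $ j + f j (\<nu> $ j) + (\<Sum>a\<in>UNIV. \<theta> $ a $ j * \<nu> $ a))"

definition CNE ::
  "real ^ 'x::finite \<Rightarrow> real ^ 'y::finite ^ 'x \<Rightarrow> ('y \<Rightarrow> real \<Rightarrow> real) \<Rightarrow> real ^ 'y ^ 'y
     \<Rightarrow> real ^ 'y \<Rightarrow> real ^ 'y ^ 'x \<Rightarrow> bool" where
  "CNE \<mu> c f \<theta> k \<gamma> \<longleftrightarrow>
     is_arg_min (total_cost (agent_cost c f \<theta> (marginal2 \<gamma>) k)) (\<lambda>\<gamma>'. \<gamma>' \<in> plans_from \<mu>) \<gamma>"

definition SCNE ::
  "real ^ 'x::finite \<Rightarrow> real ^ 'y::finite ^ 'x \<Rightarrow> ('y \<Rightarrow> real \<Rightarrow> real) \<Rightarrow> real ^ 'y ^ 'y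
     \<Rightarrow> (real ^ 'y) set \<Rightarrow> ((real ^ 'y) \<times> (real ^ 'y) \<Rightarrow> real)
     \<Rightarrow> (real ^ 'y ^ 'x) \<times> (real ^ 'y) \<Rightarrow> bool" where
  "SCNE \<mu> c f \<theta> K G = (\<lambda>(\<gamma>s, ks).
     \<gamma>s \<in> plans_from \<mu> \<and> ks \<in> K \<and> CNE \<mu> c f \<theta> ks \<gamma>s \<and>
     (\<forall>k\<in>K. \<forall>\<gamma>. CNE \<mu> c f \<theta> k \<gamma> \<longrightarrow> G (marginal2 \<gamma>s, ks) \<le> G (marginal2 \<gamma>, k)))"

end

theory Submission
  imports Defs
begin

text \<open>
  Along \<open>k = - \<phi> - \<nabla>E[\<nu>]\<close> the cost seen by the agents at \<open>\<nu>\<close> is \<open>c\<^sub>i\<^sub>j - \<phi>\<^sub>j\<close>, so the subgradient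
  inequality for \<open>\<phi>\<close> is precisely the optimality of \<open>\<gamma>\<close> among all plans with first marginal \<open>\<mu>\<close>.
  Since the leader's objective ignores \<open>k\<close>, steering the equilibrium to a global minimizer of it is
  optimal. A subgradient at a relative interior point comes from a hyperplane supporting the convex
  set of achievable pairs (cost or more, second marginal); the interiority excludes a vertical one.
\<close>

section \<open>Linearity of costs and marginals, convexity of the simplex and of the plans\<close>

lemma linear_total_cost: "linear (total_cost c)"
  by (rule linearI)
     (simp_all add: total_cost_def sum.distrib distrib_left sum_distrib_left mult.left_commute)

lemma linear_marginal1: "linear marginal1"
  by (rule linearI) (simp_all add: marginal1_def vec_eq_iff sum.distrib sum_distrib_left)

lemma linear_marginal2: "linear marginal2"
  by (rule linearI) (simp_all add: marginal2_def vec_eq_iff sum.distrib sum_distrib_left)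

text \<open>A nonnegative summand never exceeds the whole sum, so the upper bounds by 1 are
  automatic. What remains is linear and easy to check for convex combinations and for
  limits.\<close>

lemma prob_simplex_iff: "\<omega> \<in> prob_simplex \<longleftrightarrow> (\<forall>i. 0 \<le> \<omega> $ i) \<and> (\<Sum>i\<in>UNIV. \<omega> $ i) = 1"
proof -
  have "\<omega> $ i \<le> 1" if "\<forall>i. 0 \<le> \<omega> $ i" "(\<Sum>i\<in>UNIV. \<omega> $ i) = 1" for i
    using member_le_sum[of i UNIV "\<lambda>i. \<omega> $ i"] that by simp
  then show ?thesis
    by (auto simp: prob_simplex_def)
qed

lemma prob_matrices_iff:
  "\<gamma> \<in> prob_matrices \<longleftrightarrow> (\<forall>i j. 0 \<le> \<gamma> $ i $ j) \<and> (\<Sum>i\<in>UNIV. \<Sum>j\<in>UNIV. \<gamma> $ i $ j) = 1"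
proof -
  have "\<gamma> $ i $ j \<le> 1"
    if nonneg: "\<forall>i j. 0 \<le> \<gamma> $ i $ j" and one: "(\<Sum>i\<in>UNIV. \<Sum>j\<in>UNIV. \<gamma> $ i $ j) = 1" for i j
  proof -
    have "\<gamma> $ i $ j \<le> (\<Sum>j\<in>UNIV. \<gamma> $ i $ j)"
      using nonneg by (intro member_le_sum) auto
    also have "\<dots> \<le> (\<Sum>i\<in>UNIV. \<Sum>j\<in>UNIV. \<gamma> $ i $ j)"
      using nonneg by (intro member_le_sum[of i UNIV "\<lambda>i. \<Sum>j\<in>UNIV. \<gamma> $ i $ j"]) (auto intro: sum_nonneg)
    finally show ?thesis
      using one by simp
  qed
  then show ?thesis
    by (auto simp: prob_matrices_def)
qed

lemma convex_prob_simplex: "convex prob_simplex"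
  by (rule convexI) (simp add: prob_simplex_iff sum.distrib flip: sum_distrib_left)

lemma convex_prob_matrices: "convex prob_matrices"
  by (rule convexI) (simp add: prob_matrices_iff sum.distrib flip: sum_distrib_left)

lemma convex_plans_from: "convex (plans_from \<mu> :: (real ^ 'y::finite ^ 'x::finite) set)"
proof -
  have "plans_from \<mu> = (prob_matrices :: (real ^ 'y ^ 'x) set) \<inter> marginal1 -` {\<mu>}"
    by (auto simp: plans_from_def)
  then show ?thesis
    by (simp only:) (intro convex_Int convex_prob_matrices convex_linear_vimage
        linear_marginal1 convex_singleton)
qed

lemma marginal2_in_prob_simplex: "\<gamma> \<in> prob_matrices \<Longrightarrow> marginal2 \<gamma> \<in> prob_simplex"
  unfolding prob_simplex_iff prob_matrices_iff marginal2_def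
  using sum.swap[of "\<lambda>i j. \<gamma> $ i $ j" UNIV UNIV] by (auto intro: sum_nonneg)

section \<open>Existence of optimal couplings\<close>

lemma couplings_nonempty:
  fixes \<mu> :: "real ^ 'x::finite" and \<nu> :: "real ^ 'y::finite"
  assumes "\<mu> \<in> prob_simplex" "\<nu> \<in> prob_simplex"
  shows "couplings \<mu> \<nu> \<noteq> {}"
proof -
  have "(\<chi> i j. \<mu> $ i * \<nu> $ j) \<in> couplings \<mu> \<nu>"
    using assms
    by (simp add: couplings_def prob_matrices_iff prob_simplex_iff marginal1_def marginal2_def
        vec_eq_iff flip: sum_distrib_left sum_distrib_right)
  then show ?thesis
    by blast
qed

lemma compact_prob_matrices: "compact (prob_matrices :: (real ^ 'y::finite ^ 'x::finite) set)"
proof -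
  have "norm \<gamma> \<le> 1" if "\<gamma> \<in> prob_matrices" for \<gamma> :: "real ^ 'y ^ 'x"
  proof -
    \<comment> \<open>The Euclidean norm is dominated by the sum of absolute entries, which for a
      probability matrix is its total mass 1.\<close>
    have "norm \<gamma> \<le> (\<Sum>i\<in>UNIV. norm (\<gamma> $ i))"
      unfolding norm_vec_def by (rule L2_set_le_sum) simp
    also have "\<dots> \<le> (\<Sum>i\<in>UNIV. \<Sum>j\<in>UNIV. \<bar>\<gamma> $ i $ j\<bar>)"
      by (intro sum_mono norm_le_l1_cart)
    also have "\<dots> = 1"
      using that by (simp add: prob_matrices_iff)
    finally show ?thesis .
  qed
  then have "bounded (prob_matrices :: (real ^ 'y ^ 'x) set)"
    by (meson boundedI)
  moreover have "closed (prob_matrices :: (real ^ 'y ^ 'x) set)"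
  proof -
    have eq: "(prob_matrices :: (real ^ 'y ^ 'x) set)
        = {\<gamma>. (\<forall>i j. 0 \<le> \<gamma> $ i $ j) \<and> (\<Sum>i\<in>UNIV. \<Sum>j\<in>UNIV. \<gamma> $ i $ j) = 1}"
      by (rule set_eqI) (simp add: prob_matrices_iff)
    show ?thesis
      unfolding eq
      by (intro closed_Collect_conj closed_Collect_all closed_Collect_le closed_Collect_eq
          continuous_intros)
  qed
  ultimately show ?thesis
    by (simp add: compact_eq_bounded_closed)
qed

lemma compact_couplings: "compact (couplings \<mu> \<nu>)"
proof -
  have "couplings \<mu> \<nu> = prob_matrices \<inter> (marginal1 -` {\<mu>} \<inter> marginal2 -` {\<nu>})"
    by (auto simp: couplings_def)
  then show ?thesis
    by (auto intro!: compact_Int_closed compact_prob_matrices closed_Int continuous_closed_vimage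
        linear_continuous_at linear_conv_bounded_linear[THEN iffD1] linear_marginal1 linear_marginal2)
qed

text \<open>A linear cost is continuous and attains its infimum on the compact nonempty set of
  couplings; hence the \<open>INF\<close> in \<open>OT\<close> is a true minimum.\<close>

lemma OT_optimizer_exists:
  assumes "\<mu> \<in> prob_simplex" "\<nu> \<in> prob_simplex"
  obtains \<gamma> where "OT_optimizer \<mu> \<nu> c \<gamma>"
proof -
  have "continuous_on (couplings \<mu> \<nu>) (total_cost c)"
    by (simp add: linear_continuous_on linear_conv_bounded_linear[THEN iffD1] linear_total_cost)
  from continuous_attains_inf[OF compact_couplings couplings_nonempty[OF assms] this]
  show ?thesis
    using that by (auto simp: OT_optimizer_def is_arg_min_linorder)
qed

section \<open>Transport values, subgradients and the equilibria they induce\<close>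

lemma OT_eq_total_cost: "OT_optimizer \<mu> \<nu> c \<gamma> \<Longrightarrow> OT \<mu> \<nu> c = total_cost c \<gamma>"
  unfolding OT_def OT_optimizer_def is_arg_min_linorder by (intro cInf_eq_minimum) auto

lemma OT_le_total_cost:
  assumes "\<mu> \<in> prob_simplex" "\<gamma> \<in> plans_from \<mu>"
  shows "OT \<mu> (marginal2 \<gamma>) c \<le> total_cost c \<gamma>"
proof -
  have "marginal2 \<gamma> \<in> prob_simplex"
    using assms(2) by (simp add: plans_from_def marginal2_in_prob_simplex)
  then obtain \<gamma>' where \<gamma>': "OT_optimizer \<mu> (marginal2 \<gamma>) c \<gamma>'"
    using OT_optimizer_exists assms(1) by metis
  moreover have "\<gamma> \<in> couplings \<mu> (marginal2 \<gamma>)"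
    using assms(2) by (simp add: plans_from_def couplings_def)
  ultimately show ?thesis
    by (simp add: OT_eq_total_cost OT_optimizer_def is_arg_min_linorder)
qed

text \<open>Minimizing first over couplings with a given second marginal and then over that marginal
  amounts to minimizing over all plans with first marginal \<mu>. This replaces \<open>OT\<close> on
  the right-hand side by an expression linear in \<gamma>.\<close>

lemma OT_subdifferential_iff:
  fixes \<mu> :: "real ^ 'x::finite" and \<nu> :: "real ^ 'y::finite"
  assumes "\<mu> \<in> prob_simplex"
  shows "\<phi> \<in> OT_subdifferential \<mu> \<nu> c \<longleftrightarrow>
    (\<forall>\<gamma>\<in>plans_from \<mu>. OT \<mu> \<nu> c - \<phi> \<bullet> \<nu> \<le> total_cost c \<gamma> - \<phi> \<bullet> marginal2 \<gamma>)" (is "_ \<longleftrightarrow> ?R")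
proof
  assume \<phi>: "\<phi> \<in> OT_subdifferential \<mu> \<nu> c"
  show ?R
  proof
    fix \<gamma> :: "real ^ 'y ^ 'x"
    assume \<gamma>: "\<gamma> \<in> plans_from \<mu>"
    then have "marginal2 \<gamma> \<in> prob_simplex"
      by (simp add: plans_from_def marginal2_in_prob_simplex)
    with \<phi> have "OT \<mu> \<nu> c - \<phi> \<bullet> \<nu> \<le> OT \<mu> (marginal2 \<gamma>) c - \<phi> \<bullet> marginal2 \<gamma>"
      by (simp add: OT_subdifferential_def)
    with OT_le_total_cost[OF assms \<gamma>, of c]
    show "OT \<mu> \<nu> c - \<phi> \<bullet> \<nu> \<le> total_cost c \<gamma> - \<phi> \<bullet> marginal2 \<gamma>"
      by linarith
  qed
next
  assume R: ?R
  have "OT \<mu> \<nu> c - \<phi> \<bullet> \<nu> \<le> OT \<mu> \<eta> c - \<phi> \<bullet> \<eta>" if \<eta>: "\<eta> \<in> prob_simplex" for \<eta>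
  proof -
    obtain \<gamma> where \<gamma>: "OT_optimizer \<mu> \<eta> c \<gamma>"
      using OT_optimizer_exists assms \<eta> by metis
    then have "\<gamma> \<in> plans_from \<mu>" "marginal2 \<gamma> = \<eta>"
      by (auto simp: OT_optimizer_def is_arg_min_def couplings_def plans_from_def)
    with R show ?thesis
      by (auto simp: OT_eq_total_cost[OF \<gamma>])
  qed
  then show "\<phi> \<in> OT_subdifferential \<mu> \<nu> c"
    by (simp add: OT_subdifferential_def)
qed

text \<open>The terms added to \<open>c\<close> depend on the action only, so summing over types
  leaves their pairing with the second marginal. Here \<nu> is frozen and need not be the marginal
  of \<gamma>.\<close>

lemma total_cost_agent_cost:
  "total_cost (agent_cost c f \<theta> \<nu> k) \<gamma>
     = total_cost c \<gamma> + (k + grad_energy f \<theta> \<nu>) \<bullet> marginal2 \<gamma>"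
proof -
  define h where "h = k + grad_energy f \<theta> \<nu>"
  have "agent_cost c f \<theta> \<nu> k $ i $ j = c $ i $ j + h $ j" for i j
    by (simp add: agent_cost_def grad_energy_def h_def)
  then have "total_cost (agent_cost c f \<theta> \<nu> k) \<gamma>
      = total_cost c \<gamma> + (\<Sum>i\<in>UNIV. \<Sum>j\<in>UNIV. h $ j * \<gamma> $ i $ j)"
    by (simp add: total_cost_def distrib_right sum.distrib)
  also have "(\<Sum>i\<in>UNIV. \<Sum>j\<in>UNIV. h $ j * \<gamma> $ i $ j) = h \<bullet> marginal2 \<gamma>"
    by (subst sum.swap) (simp add: inner_vec_def marginal2_def sum_distrib_left)
  finally show ?thesis
    by (simp add: h_def)
qed

lemma CNE_of_subgradient:
  assumes "\<mu> \<in> prob_simplex" and \<gamma>: "OT_optimizer \<mu> \<nu> c \<gamma>"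
    and \<phi>: "\<phi> \<in> OT_subdifferential \<mu> \<nu> c"
  shows "CNE \<mu> c f \<theta> (- \<phi> - grad_energy f \<theta> \<nu>) \<gamma>"
proof -
  have "\<gamma> \<in> plans_from \<mu>" and marg: "marginal2 \<gamma> = \<nu>"
    using \<gamma> by (auto simp: OT_optimizer_def is_arg_min_def couplings_def plans_from_def)
  \<comment> \<open>Once \<open>marg\<close> freezes the congestion at \<nu>, the gradient cancels
    and minimality over plans is the plan-wise form of the subgradient inequality.\<close>
  then show ?thesis
    using \<phi> unfolding CNE_def is_arg_min_linorder marg total_cost_agent_cost
    by (simp add: OT_subdifferential_iff[OF assms(1)] OT_eq_total_cost[OF \<gamma>])
qed

section \<open>Existence of a subgradient at relative interior points\<close>

lemma OT_subdifferential_nonempty: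
  fixes \<mu> :: "real ^ 'x::finite" and \<nu> :: "real ^ 'y::finite" and c :: "real ^ 'y ^ 'x"
  assumes \<mu>: "\<mu> \<in> prob_simplex" and \<nu>: "\<nu> \<in> rel_interior prob_simplex"
  shows "OT_subdifferential \<mu> \<nu> c \<noteq> {}"
proof -
  define m where "m = OT \<mu> \<nu> c"
  \<comment> \<open>This is the epigraph of \<open>OT\<close> in its second argument, with the value
    as first coordinate. Writing it through plans reduces its convexity to the linearity of cost and
    marginal.\<close>
  define S :: "(real \<times> (real ^ 'y)) set" where
    "S = {(t, v). \<exists>\<gamma>\<in>plans_from \<mu>. total_cost c \<gamma> \<le> t \<and> v = marginal2 \<gamma>}"
  have \<nu>_mem: "\<nu> \<in> prob_simplex"
    using \<nu> rel_interior_subset by blast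
  have SI: "(t, marginal2 \<gamma>) \<in> S" if "\<gamma> \<in> plans_from \<mu>" "total_cost c \<gamma> \<le> t" for t \<gamma>
    using that by (auto simp: S_def)
  have onto: "\<exists>t. (t, \<eta>) \<in> S" if \<eta>: "\<eta> \<in> prob_simplex" for \<eta>
  proof -
    obtain \<gamma> where "\<gamma> \<in> couplings \<mu> \<eta>"
      using couplings_nonempty[OF \<mu> \<eta>] by blast
    then show ?thesis
      using SI[of \<gamma> "total_cost c \<gamma>"] by (auto simp: couplings_def plans_from_def)
  qed
  have S_above: "m \<le> t" if t: "(t, \<nu>) \<in> S" for t
  proof -
    obtain \<gamma> where "\<gamma> \<in> plans_from \<mu>" "total_cost c \<gamma> \<le> t" "\<nu> = marginal2 \<gamma>"
      using t by (auto simp: S_def)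
    then show ?thesis
      using OT_le_total_cost[OF \<mu>, of \<gamma> c] by (simp add: m_def)
  qed
  obtain \<gamma>0 where \<gamma>0: "OT_optimizer \<mu> \<nu> c \<gamma>0"
    using OT_optimizer_exists \<mu> \<nu>_mem by metis
  then have \<gamma>0_plan: "\<gamma>0 \<in> plans_from \<mu>" "marginal2 \<gamma>0 = \<nu>"
    by (auto simp: OT_optimizer_def is_arg_min_def couplings_def plans_from_def)
  \<comment> \<open>Attainment of the minimum by \<open>\<gamma>0\<close> puts the endpoint
    \<open>(m, \<nu>)\<close> itself into \<open>S\<close>, as the supporting hyperplane
    requires.\<close>
  have up: "(t, \<nu>) \<in> S" if "m \<le> t" for t
    using SI[OF \<gamma>0_plan(1), of t] \<gamma>0_plan(2) that by (simp add: m_def OT_eq_total_cost[OF \<gamma>0])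
  have convS: "convex S"
  proof (rule convexI)
    fix p q :: "real \<times> (real ^ 'y)" and u w :: real
    assume p: "p \<in> S" and q: "q \<in> S" and uw: "0 \<le> u" "0 \<le> w" "u + w = 1"
    obtain \<gamma> where \<gamma>: "\<gamma> \<in> plans_from \<mu>" "total_cost c \<gamma> \<le> fst p" "snd p = marginal2 \<gamma>"
      using p by (auto simp: S_def)
    obtain \<delta> where \<delta>: "\<delta> \<in> plans_from \<mu>" "total_cost c \<delta> \<le> fst q" "snd q = marginal2 \<delta>"
      using q by (auto simp: S_def)
    have "u *\<^sub>R \<gamma> + w *\<^sub>R \<delta> \<in> plans_from \<mu>"
      using convexD[OF convex_plans_from \<gamma>(1) \<delta>(1)] uw by simp
    moreover have "total_cost c (u *\<^sub>R \<gamma> + w *\<^sub>R \<delta>) \<le> u * fst p + w * fst q"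
      using \<gamma>(2) \<delta>(2) uw
      by (simp add: linear_add[OF linear_total_cost] linear_cmul[OF linear_total_cost]
          add_mono mult_left_mono)
    ultimately have "(u * fst p + w * fst q, marginal2 (u *\<^sub>R \<gamma> + w *\<^sub>R \<delta>)) \<in> S"
      by (rule SI)
    then show "u *\<^sub>R p + w *\<^sub>R q \<in> S"
      using \<gamma>(3) \<delta>(3)
      by (simp add: linear_add[OF linear_marginal2] linear_cmul[OF linear_marginal2]
          plus_prod_def scaleR_prod_def)
  qed
  \<comment> \<open>Otherwise the segment from \<open>(m + 1, \<nu>)\<close> to
    \<open>(m, \<nu>)\<close> could be prolonged inside \<open>S\<close>, reaching a point over
    \<nu> strictly below the minimal cost \<open>m\<close>.\<close>
  have "(m, \<nu>) \<notin> rel_interior S"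
  proof
    assume "(m, \<nu>) \<in> rel_interior S"
    moreover have "(m + 1, \<nu>) \<in> S"
      by (rule up) simp
    ultimately obtain e where e: "e > 1" "(1 - e) *\<^sub>R (m + 1, \<nu>) + e *\<^sub>R (m, \<nu>) \<in> S"
      using convex_rel_interior_iff[OF convS] by blast
    moreover have "(1 - e) *\<^sub>R (m + 1, \<nu>) + e *\<^sub>R (m, \<nu>) = (m + 1 - e, \<nu>)"
      by (simp add: algebra_simps)
    ultimately show False
      using S_above by force
  qed
  from supporting_hyperplane_rel_boundary[OF convS up[OF order_refl] this]
  obtain a where a: "\<And>y. y \<in> S \<Longrightarrow> a \<bullet> (m, \<nu>) \<le> a \<bullet> y"
    and a_strict: "\<And>y. y \<in> rel_interior S \<Longrightarrow> a \<bullet> (m, \<nu>) < a \<bullet> y"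
    by metis
  obtain \<alpha> \<beta> where \<alpha>\<beta>: "a = (\<alpha>, \<beta>)"
    by fastforce
  have le: "\<alpha> * m + \<beta> \<bullet> \<nu> \<le> \<alpha> * t + \<beta> \<bullet> v" if "(t, v) \<in> S" for t v
    using a[OF that] by (simp add: \<alpha>\<beta>)
  have "0 \<le> \<alpha>"
    using le[OF up[of "m + 1"]] by (simp add: algebra_simps)
  \<comment> \<open>A vertical hyperplane would give some \<open>v\<close> in the simplex with
    \<open>\<beta> \<bullet> \<nu> < \<beta> \<bullet> v\<close>, by strictness on the relative
    interior. Since \<nu> is relatively interior, the segment from \<open>v\<close> can be prolonged
    beyond \<nu>, and support at the prolonged point gives the opposite inequality.\<close>
  moreover have "\<alpha> \<noteq> 0"
  proof
    assume "\<alpha> = 0"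
    have "rel_interior S \<noteq> {}"
      using up[of m] convS by (auto simp: rel_interior_eq_empty)
    then obtain t v where tv: "(t, v) \<in> rel_interior S"
      by auto
    then have "(t, v) \<in> S"
      using rel_interior_subset by blast
    then have "v \<in> prob_simplex"
      by (auto simp: S_def plans_from_def marginal2_in_prob_simplex)
    then obtain e where e: "e > 1" "(1 - e) *\<^sub>R v + e *\<^sub>R \<nu> \<in> prob_simplex"
      using \<nu> convex_rel_interior_iff[OF convex_prob_simplex] by blast
    from onto[OF e(2)] obtain s where "(s, (1 - e) *\<^sub>R v + e *\<^sub>R \<nu>) \<in> S"
      by blast
    from le[OF this] have "(e - 1) * (\<beta> \<bullet> v) \<le> (e - 1) * (\<beta> \<bullet> \<nu>)"
      by (simp add: \<open>\<alpha> = 0\<close> inner_add_right algebra_simps)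
    moreover have "\<beta> \<bullet> \<nu> < \<beta> \<bullet> v"
      using a_strict[OF tv] by (simp add: \<alpha>\<beta> \<open>\<alpha> = 0\<close>)
    ultimately show False
      using e(1) by simp
  qed
  ultimately have "0 < \<alpha>"
    by simp
  \<comment> \<open>Dividing by the positive cost coefficient \<alpha> normalizes the hyperplane to
    the graph of an affine minorant, whose slope is the subgradient.\<close>
  have "m + \<beta> \<bullet> \<nu> / \<alpha> \<le> total_cost c \<gamma> + \<beta> \<bullet> marginal2 \<gamma> / \<alpha>" if "\<gamma> \<in> plans_from \<mu>" for \<gamma>
    using divide_right_mono[OF le[OF SI[OF that order_refl]], of \<alpha>] \<open>0 < \<alpha>\<close>
    by (simp add: add_divide_distrib)
  then have "- (\<beta> /\<^sub>R \<alpha>) \<in> OT_subdifferential \<mu> \<nu> c"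
    by (simp add: OT_subdifferential_iff[OF \<mu>] m_def divide_inverse_commute)
  then show ?thesis
    by blast
qed

section \<open>Optimality for the leader and existence of a Stackelberg equilibrium\<close>

theorem corollary5p8:
  fixes \<mu> :: "real ^ 'x::finite"
    and c :: "real ^ 'y::finite ^ 'x"
    and f :: "'y \<Rightarrow> real \<Rightarrow> real"
    and \<theta> :: "real ^ 'y ^ 'y"
    and K :: "(real ^ 'y) set"
    and G :: "(real ^ 'y) \<times> (real ^ 'y) \<Rightarrow> real"
    and g :: "real ^ 'y \<Rightarrow> real"
    and \<nu>s :: "real ^ 'y"
  assumes "\<mu> \<in> prob_simplex"
    and "\<And>j. continuous_on {0..1} (f j)"
    and "\<And>j. mono_on {0..1} (f j)"
    and "transpose \<theta> = \<theta>"
    and "continuous_on (prob_simplex \<times> K) G"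
    and "convex_on prob_simplex (energy f \<theta>)"
    and "\<And>\<nu> k. \<nu> \<in> prob_simplex \<Longrightarrow> k \<in> K \<Longrightarrow> G (\<nu>, k) = g \<nu>"
    and "is_arg_min g (\<lambda>\<nu>. \<nu> \<in> prob_simplex) \<nu>s"
  shows "(\<forall>\<gamma>s. OT_optimizer \<mu> \<nu>s c \<gamma>s \<longrightarrow>
            (\<forall>ks \<in> (\<lambda>\<phi>. - \<phi> - grad_energy f \<theta> \<nu>s) ` OT_subdifferential \<mu> \<nu>s c \<inter> K.
               SCNE \<mu> c f \<theta> K G (\<gamma>s, ks)))
       \<and> (\<nu>s \<in> rel_interior prob_simplex \<and> K = UNIV \<longrightarrow>
            (\<exists>\<gamma> k. SCNE \<mu> c f \<theta> K G (\<gamma>, k)))"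
proof -
  have \<nu>s: "\<nu>s \<in> prob_simplex" and min: "\<And>\<nu>. \<nu> \<in> prob_simplex \<Longrightarrow> g \<nu>s \<le> g \<nu>"
    using assms(8) by (auto simp: is_arg_min_linorder)
  have SCNE: "SCNE \<mu> c f \<theta> K G (\<gamma>s, ks)"
    if \<gamma>s: "OT_optimizer \<mu> \<nu>s c \<gamma>s" and \<phi>: "\<phi> \<in> OT_subdifferential \<mu> \<nu>s c"
      and ks: "ks = - \<phi> - grad_energy f \<theta> \<nu>s" "ks \<in> K" for \<gamma>s ks \<phi>
  proof -
    have "CNE \<mu> c f \<theta> ks \<gamma>s"
      unfolding ks(1) by (rule CNE_of_subgradient[OF assms(1) \<gamma>s \<phi>])
    moreover have "\<gamma>s \<in> plans_from \<mu>" "marginal2 \<gamma>s = \<nu>s"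
      using \<gamma>s by (auto simp: OT_optimizer_def is_arg_min_def couplings_def plans_from_def)
    \<comment> \<open>Every competing equilibrium, for whatever \<open>k\<close>, induces a marginal
      in the simplex, where \<open>g\<close> is at least \<open>g \<nu>s\<close>.\<close>
    moreover have "marginal2 \<gamma> \<in> prob_simplex" if "CNE \<mu> c f \<theta> k \<gamma>" for k \<gamma>
      using that by (simp add: CNE_def is_arg_min_def plans_from_def marginal2_in_prob_simplex)
    ultimately show ?thesis
      using assms(7) \<nu>s min ks(2) by (simp add: SCNE_def)
  qed
  moreover have "\<exists>\<gamma> k. SCNE \<mu> c f \<theta> K G (\<gamma>, k)"
    if interior: "\<nu>s \<in> rel_interior prob_simplex" and "K = UNIV"
  proof -
    \<comment> \<open>With every \<open>k\<close> admissible, any optimizer and any subgradient at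
      \<open>\<nu>s\<close> combine to an equilibrium.\<close>
    obtain \<gamma>s where "OT_optimizer \<mu> \<nu>s c \<gamma>s"
      using OT_optimizer_exists[OF assms(1) \<nu>s] by blast
    moreover obtain \<phi> where "\<phi> \<in> OT_subdifferential \<mu> \<nu>s c"
      using OT_subdifferential_nonempty[OF assms(1) interior] by blast
    ultimately show ?thesis
      using SCNE \<open>K = UNIV\<close> by blast
  qed
  ultimately show ?thesis
    by blast
qed

end
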